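(* Let $\alpha,\beta,a,b,c,d,e\ge 0$ be real numbers with $a+b=1$, $\alpha+\beta=1$, $c+d+e=1$, and let $V:S^2\to S^2$ be the operator $V(x_1,x_2,x_3)=(x_1',x_2',x_3')$ given by $$x_1'=\alpha x_2^2+cx_3^2+2x_2x_3,\qquad x_2'=ax_1^2+dx_3^2+2x_1x_3,\qquad x_3'=bx_1^2+\beta x_2^2+ex_3^2+2x_1x_2 .$$ If $e\neq 1$, then $V$ has a unique fixed point $x^*=(x_1^*,x_2^*,x_3^* )\in S^2$. If $e=1$, then $V$ has exactly two fixed points in $S^2$, one of which is $(0,0,1)$.
   Context: $S^2=\{(x_1,x_2,x_3)\in\mathbb{R}^3: x_i\ge 0,\ x_1+x_2+x_3=1\}$ is the two-dimensional simplex. A fixed point of $V$ is a point $x\in S^2$ with $V(x)=x$. *)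

theory Defs
  imports "HOL-Analysis.Analysis"
begin

definition simplex2 :: "(real ^ 3) set" where
  "simplex2 = {x. (\<forall>i. 0 \<le> x $ i) \<and> x $ 1 + x $ 2 + x $ 3 = 1}"

definition V_op ::
  "real \<Rightarrow> real \<Rightarrow> real \<Rightarrow> real \<Rightarrow> real \<Rightarrow> real \<Rightarrow> real \<Rightarrow> real ^ 3 \<Rightarrow> real ^ 3"
where
  "V_op \<alpha> \<beta> a b c d e x = vector
     [\<alpha> * (x $ 2)\<^sup>2 + c * (x $ 3)\<^sup>2 + 2 * x $ 2 * x $ 3,
      a * (x $ 1)\<^sup>2 + d * (x $ 3)\<^sup>2 + 2 * x $ 1 * x $ 3,
      b * (x $ 1)\<^sup>2 + \<beta> * (x $ 2)\<^sup>2 + e * (x $ 3)\<^sup>2 + 2 * x $ 1 * x $ 2]"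

lemma V_op_maps_simplex2:
  assumes "\<alpha> \<ge> 0" "\<beta> \<ge> 0" "a \<ge> 0" "b \<ge> 0" "c \<ge> 0" "d \<ge> 0" "e \<ge> 0"
    and "a + b = 1" "\<alpha> + \<beta> = 1" "c + d + e = 1"
  shows "V_op \<alpha> \<beta> a b c d e ` simplex2 \<subseteq> simplex2"
proof clarify
  fix x assume x: "x \<in> simplex2"
  then have nn: "0 \<le> x $ 1" "0 \<le> x $ 2" "0 \<le> x $ 3" and s: "x $ 1 + x $ 2 + x $ 3 = 1"
    by (auto simp: simplex2_def)
  have b: "b = 1 - a" "\<beta> = 1 - \<alpha>" "e = 1 - c - d"
    using assms(8-10) by auto
  have "V_op \<alpha> \<beta> a b c d e x $ 1 + V_op \<alpha> \<beta> a b c d e x $ 2 + V_op \<alpha> \<beta> a b c d e x $ 3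
      = (x $ 1 + x $ 2 + x $ 3)\<^sup>2"
    unfolding b V_op_def vector_3 by (simp add: power2_eq_square algebra_simps)
  then show "V_op \<alpha> \<beta> a b c d e x \<in> simplex2"
    using nn s assms(1-7) by (simp add: simplex2_def forall_3 V_op_def)
qed

end

theory Submission
  imports Defs
begin

text \<open>
  A fixed point other than \<open>(0, 0, 1)\<close> has \<open>x\<^sub>3 \<le> 1/2\<close>, because
  \<open>x\<^sub>3 \<le> x\<^sub>3\<^sup>2 + (x\<^sub>1 + x\<^sub>2)\<^sup>2\<close>. As \<open>V\<close> is quadratic, the difference of two fixed points
  satisfies a linear system with coefficients given by their midpoint \<open>m\<close>; after eliminating the
  third coordinate, \<open>m\<^sub>3 \<le> 1/2\<close> forces this \<open>2 \<times> 2\<close> system to be nonsingular. Existence is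
  Brouwer's theorem if \<open>e \<noteq> 1\<close>. If \<open>e = 1\<close>, then \<open>c = d = 0\<close>, the first two
  equations give \<open>x\<^sub>1\<close> as a function of \<open>x\<^sub>2\<close> and vice versa, and the intermediate value
  theorem applied to the composition yields a fixed point with \<open>x\<^sub>2 > 0\<close>.
\<close>

section \<open>Topology of the simplex and continuity of the operator\<close>

lemma simplex2_iff:
  "x \<in> simplex2 \<longleftrightarrow> 0 \<le> x $ 1 \<and> 0 \<le> x $ 2 \<and> 0 \<le> x $ 3 \<and> x $ 1 + x $ 2 + x $ 3 = 1"
  by (auto simp: simplex2_def forall_3)

lemma compact_simplex2: "compact simplex2"
proof -
  have "closed simplex2"
    unfolding simplex2_def by (intro closed_Collect_conj closed_Collect_all closed_Collect_le
        closed_Collect_eq continuous_intros)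
  moreover have "bounded simplex2"
  proof (rule boundedI)
    fix x :: "real ^ 3" assume "x \<in> simplex2"
    then show "norm x \<le> 1"
      using norm_le_l1_cart[of x] by (simp add: simplex2_iff sum_3)
  qed
  ultimately show ?thesis
    by (simp add: compact_eq_bounded_closed)
qed

lemma convex_simplex2: "convex simplex2"
proof (rule convexI)
  fix x y :: "real ^ 3" and u v :: real
  assume *: "x \<in> simplex2" "y \<in> simplex2" "0 \<le> u" "0 \<le> v" "u + v = 1"
  have "u * (x $ 1 + x $ 2 + x $ 3) + v * (y $ 1 + y $ 2 + y $ 3) = 1"
    using * by (simp add: simplex2_iff)
  then show "u *\<^sub>R x + v *\<^sub>R y \<in> simplex2"
    using * by (simp add: simplex2_iff algebra_simps)
qed

lemma vertex3_in_simplex2: "vector [0, 0, 1] \<in> simplex2"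
  by (simp add: simplex2_iff)

lemma continuous_on_V_op: "continuous_on S (V_op \<alpha> \<beta> a b c d e)"
proof -
  have "continuous_on S (\<lambda>x. V_op \<alpha> \<beta> a b c d e x $ i)" for i
    using exhaust_3[of i]
    by (elim disjE) (simp_all add: V_op_def, (intro continuous_intros)+)
  then have "continuous_on S (\<lambda>x. \<chi> i. V_op \<alpha> \<beta> a b c d e x $ i)"
    by (rule continuous_on_vec_lambda)
  then show ?thesis by simp
qed

section \<open>Uniqueness away from the vertex\<close>

lemma V_op_fixed_iff:
  "V_op \<alpha> \<beta> a b c d e x = x \<longleftrightarrow>
    \<alpha> * (x $ 2)\<^sup>2 + c * (x $ 3)\<^sup>2 + 2 * x $ 2 * x $ 3 = x $ 1 \<and>
    a * (x $ 1)\<^sup>2 + d * (x $ 3)\<^sup>2 + 2 * x $ 1 * x $ 3 = x $ 2 \<and>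
    b * (x $ 1)\<^sup>2 + \<beta> * (x $ 2)\<^sup>2 + e * (x $ 3)\<^sup>2 + 2 * x $ 1 * x $ 2 = x $ 3"
  by (simp add: vec_eq_iff forall_3 V_op_def)

lemma V_op_fixed_coord3_le_half:
  assumes "b \<le> 1" "\<beta> \<le> 1" "e \<le> 1"
    and x: "x \<in> simplex2" "V_op \<alpha> \<beta> a b c d e x = x" and ne: "x \<noteq> vector [0, 0, 1]"
  shows "x $ 3 \<le> 1 / 2"
proof -
  have s: "0 \<le> x $ 1" "0 \<le> x $ 2" "0 \<le> x $ 3" "x $ 1 + x $ 2 = 1 - x $ 3"
    using x by (auto simp: simplex2_iff)
  have "x $ 3 \<noteq> 1"
    using ne s by (auto simp: vec_eq_iff forall_3)
  then have lt: "0 < 1 - x $ 3" using s by linarith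
  have sq: "k * t\<^sup>2 \<le> t\<^sup>2" if "k \<le> 1" for k t :: real
    using mult_right_mono[OF that, of "t\<^sup>2"] by simp
  have "x $ 3 = b * (x $ 1)\<^sup>2 + \<beta> * (x $ 2)\<^sup>2 + e * (x $ 3)\<^sup>2 + 2 * x $ 1 * x $ 2"
    using x(2) by (simp add: V_op_fixed_iff)
  also have "\<dots> \<le> (x $ 1)\<^sup>2 + (x $ 2)\<^sup>2 + (x $ 3)\<^sup>2 + 2 * x $ 1 * x $ 2"
    using assms(1-3) by (intro add_mono order_refl sq)
  also have "\<dots> = (x $ 1 + x $ 2)\<^sup>2 + (x $ 3)\<^sup>2"
    by (simp add: power2_eq_square algebra_simps)
  \<comment> \<open>Since \<open>x $ 1 + x $ 2 = 1 - x $ 3\<close>, the bound factors; the common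
    factor vanishes only at the excluded vertex.\<close>
  finally have "x $ 3 * (1 - x $ 3) \<le> (1 - x $ 3) * (1 - x $ 3)"
    unfolding s(4) by (simp add: power2_eq_square algebra_simps)
  then have "x $ 3 \<le> 1 - x $ 3"
    using lt by (rule mult_right_le_imp_le)
  then show ?thesis by simp
qed

text \<open>One weakly dominant row of the linear system; applied to both rows it gives
  \<open>\<bar>u\<bar> = \<bar>v\<bar>\<close>.\<close>

lemma abs_le_of_linear:
  fixes p t u v :: real
  assumes "p * u = t * v" "\<bar>t\<bar> \<le> p" "0 < p"
  shows "\<bar>u\<bar> \<le> \<bar>v\<bar>"
proof -
  have "p * \<bar>u\<bar> = \<bar>t\<bar> * \<bar>v\<bar>"
    using assms by (metis abs_mult abs_of_pos)
  also have "\<dots> \<le> p * \<bar>v\<bar>" using assms by (intro mult_right_mono) auto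
  finally show ?thesis using assms by simp
qed

text \<open>A strictly dominant row would give \<open>\<bar>u\<bar> < \<bar>v\<bar>\<close> unless
  both unknowns vanish.\<close>

lemma zero_of_linear:
  fixes p t u v :: real
  assumes "p * u = t * v" "\<bar>t\<bar> < p" "\<bar>v\<bar> \<le> \<bar>u\<bar>"
  shows "u = 0 \<and> v = 0"
proof (rule ccontr)
  assume "\<not> ?thesis"
  then have "0 < \<bar>u\<bar>" using assms(3) by auto
  have "p * \<bar>u\<bar> = \<bar>t\<bar> * \<bar>v\<bar>"
    using assms(1,2) by (metis abs_mult abs_of_pos abs_ge_zero order_le_less_trans)
  also have "\<dots> \<le> \<bar>t\<bar> * \<bar>u\<bar>" using assms by (intro mult_left_mono) auto
  also have "\<dots> < p * \<bar>u\<bar>" using assms \<open>0 < \<bar>u\<bar>\<close> by (intro mult_strict_right_mono)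
  finally show False by simp
qed

text \<open>The quantity inside the absolute value lies between \<open>- 2 * m\<close> and
  \<open>2 * n\<close>, and \<open>2 * n \<le> 1\<close>. The lower bound is always strict because
  of the summand 1; the upper one becomes strict through \<open>2 * m\<close>.\<close>

lemma coefficient_bound:
  fixes c \<beta> m n :: real
  assumes "0 \<le> c" "c \<le> 1" "0 \<le> \<beta>" "\<beta> \<le> 1" "0 \<le> m" "0 \<le> n" "n \<le> 1 / 2"
  shows "\<bar>2 * ((1 - c) * n - \<beta> * m)\<bar> \<le> 1 + 2 * c * n + 2 * m"
    and "0 < m \<Longrightarrow> \<bar>2 * ((1 - c) * n - \<beta> * m)\<bar> < 1 + 2 * c * n + 2 * m"
proof -
  have *: "0 \<le> c * n" "c * n \<le> n" "0 \<le> \<beta> * m" "\<beta> * m \<le> m"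
    using assms by (auto simp: mult_left_le_one_le)
  have eq: "2 * ((1 - c) * n - \<beta> * m) = 2 * n - 2 * (c * n) - 2 * (\<beta> * m)"
    "2 * c * n = 2 * (c * n)"
    by (simp_all add: algebra_simps)
  show "\<bar>2 * ((1 - c) * n - \<beta> * m)\<bar> \<le> 1 + 2 * c * n + 2 * m"
    unfolding eq using * assms by linarith
  show "0 < m \<Longrightarrow> \<bar>2 * ((1 - c) * n - \<beta> * m)\<bar> < 1 + 2 * c * n + 2 * m"
    unfolding eq using * assms by linarith
qed

lemma V_op_fixed_unique_half:
  assumes "\<alpha> \<ge> 0" "\<beta> \<ge> 0" "a \<ge> 0" "b \<ge> 0" "c \<ge> 0" "d \<ge> 0" "e \<ge> 0"
    and sums: "a + b = 1" "\<alpha> + \<beta> = 1" "c + d + e = 1"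
    and x: "x \<in> simplex2" "V_op \<alpha> \<beta> a b c d e x = x" "x $ 3 \<le> 1 / 2"
    and y: "y \<in> simplex2" "V_op \<alpha> \<beta> a b c d e y = y" "y $ 3 \<le> 1 / 2"
  shows "x = y"
proof -
  define m where "m i = (x $ i + y $ i) / 2" for i
  define u where "u = x $ 1 - y $ 1"
  define v where "v = x $ 2 - y $ 2"
  \<comment> \<open>These coefficients arise by subtracting the first (resp. second) equations for
    \<open>x\<close> and \<open>y\<close>, using \<open>x $ 3 - y $ 3 = - (u + v)\<close> and
    collecting the terms in \<open>u\<close> and \<open>v\<close>.\<close>
  define p where "p = 1 + 2 * c * m 3 + 2 * m 2"
  define q where "q = 2 * ((1 - c) * m 3 - \<beta> * m 2)"
  define r where "r = 1 + 2 * d * m 3 + 2 * m 1"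
  define s where "s = 2 * ((1 - d) * m 3 - b * m 1)"
  have m: "0 \<le> m 1" "0 \<le> m 2" "0 \<le> m 3" "m 3 \<le> 1 / 2" "m 1 + m 2 + m 3 = 1"
    using x y by (simp_all add: simplex2_iff m_def field_simps)
  have x3: "x $ 3 = 1 - x $ 1 - x $ 2" and y3: "y $ 3 = 1 - y $ 1 - y $ 2"
    using x y by (auto simp: simplex2_iff)
  have \<beta>: "\<beta> = 1 - \<alpha>" and b: "b = 1 - a" using sums by auto
  have "x $ 1 - y $ 1 = (\<alpha> * (x $ 2)\<^sup>2 + c * (x $ 3)\<^sup>2 + 2 * x $ 2 * x $ 3)
      - (\<alpha> * (y $ 2)\<^sup>2 + c * (y $ 3)\<^sup>2 + 2 * y $ 2 * y $ 3)"
    using x(2) y(2) by (simp add: V_op_fixed_iff)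
  then have pq: "p * u = q * v"
    unfolding p_def q_def u_def v_def m_def x3 y3 \<beta> by (simp add: field_simps power2_eq_square)
  have "x $ 2 - y $ 2 = (a * (x $ 1)\<^sup>2 + d * (x $ 3)\<^sup>2 + 2 * x $ 1 * x $ 3)
      - (a * (y $ 1)\<^sup>2 + d * (y $ 3)\<^sup>2 + 2 * y $ 1 * y $ 3)"
    using x(2) y(2) by (simp add: V_op_fixed_iff)
  then have rs: "r * v = s * u"
    unfolding r_def s_def u_def v_def m_def x3 y3 b by (simp add: field_simps power2_eq_square)
  have bds: "c \<le> 1" "d \<le> 1" "\<beta> \<le> 1" "b \<le> 1" using assms by auto
  have q: "\<bar>q\<bar> \<le> p" "0 < m 2 \<Longrightarrow> \<bar>q\<bar> < p"
    unfolding p_def q_def using coefficient_bound assms bds m by blast+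
  have s: "\<bar>s\<bar> \<le> r" "0 < m 1 \<Longrightarrow> \<bar>s\<bar> < r"
    unfolding r_def s_def using coefficient_bound assms bds m by blast+
  have pos: "0 < p" "0 < r"
    using m assms by (simp_all add: p_def r_def add_pos_nonneg)
  have "\<bar>u\<bar> \<le> \<bar>v\<bar>" "\<bar>v\<bar> \<le> \<bar>u\<bar>"
    using abs_le_of_linear[OF pq q(1) pos(1)] abs_le_of_linear[OF rs s(1) pos(2)] by auto
  \<comment> \<open>As \<open>m 3 \<le> 1 / 2\<close>, the other two coordinates sum to at least
    1/2, so at least one row is strictly dominant.\<close>
  moreover have "0 < m 1 \<or> 0 < m 2" using m by linarith
  ultimately have "u = 0 \<and> v = 0"
    using zero_of_linear[OF pq] zero_of_linear[OF rs] q(2) s(2) by auto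
  then show ?thesis
    using x3 y3 by (simp add: vec_eq_iff forall_3 u_def v_def)
qed

section \<open>A nontrivial fixed point when \<open>e = 1\<close>\<close>

text \<open>
  Solution \<open>x\<^sub>1\<close> of \<open>x\<^sub>1 = k * x\<^sub>2\<^sup>2 + 2 * x\<^sub>2 * (1 - x\<^sub>1 - x\<^sub>2)\<close> at \<open>x\<^sub>2 = t\<close>.
\<close>
definition section_map :: "real \<Rightarrow> real \<Rightarrow> real" where
  "section_map k t = t * (2 - (2 - k) * t) / (1 + 2 * t)"

lemma section_map_eq:
  assumes "0 \<le> t"
  shows "section_map k t = k * t\<^sup>2 + 2 * t * (1 - section_map k t - t)"
proof -
  have "section_map k t * (1 + 2 * t) = t * (2 - (2 - k) * t)"
    using assms by (simp add: section_map_def)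
  then show ?thesis by (simp add: algebra_simps power2_eq_square)
qed

text \<open>The last bound, equivalent to \<open>(4 - k) * t \<le> 1\<close> for
  \<open>t > 0\<close>, keeps the composed map above the identity near 0, away from the root
  belonging to the vertex.\<close>

lemma section_map_bounds:
  assumes "0 \<le> k" "k \<le> 1" "0 \<le> t" "t \<le> 1"
  shows "0 \<le> section_map k t" "section_map k t \<le> 2 * t / (1 + 2 * t)"
    "t \<le> 1 / 4 \<Longrightarrow> t \<le> section_map k t"
proof -
  have *: "0 \<le> k * t" "k * t \<le> t" using assms by (auto simp: mult_left_le_one_le)
  then have "0 \<le> 2 - (2 - k) * t" "2 - (2 - k) * t \<le> 2"
    unfolding left_diff_distrib using assms by linarith+
  then have "0 \<le> t * (2 - (2 - k) * t)" "t * (2 - (2 - k) * t) \<le> t * 2"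
    using mult_nonneg_nonneg[OF assms(3)] mult_left_mono[OF _ assms(3)] by blast+
  then show "0 \<le> section_map k t" "section_map k t \<le> 2 * t / (1 + 2 * t)"
    using assms by (auto simp: section_map_def intro!: divide_right_mono)
  assume "t \<le> 1 / 4"
  then have "t * (1 + 2 * t) \<le> t * (2 - (2 - k) * t)"
    using * assms unfolding left_diff_distrib by (intro mult_left_mono) linarith+
  then show "t \<le> section_map k t"
    using assms by (simp add: section_map_def pos_le_divide_eq)
qed

lemma V_op_fixed_nontrivial:
  assumes "0 \<le> \<alpha>" "0 \<le> \<beta>" "0 \<le> a" "0 \<le> b" and sums: "a + b = 1" "\<alpha> + \<beta> = 1"
  obtains x where "x \<in> simplex2" "V_op \<alpha> \<beta> a b 0 0 1 x = x" "x $ 2 > 0"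
proof -
  have le1: "\<alpha> \<le> 1" "a \<le> 1" using assms by auto
  let ?f = "section_map \<alpha>" and ?g = "section_map a"
  have f: "0 \<le> ?f t" "?f t \<le> 2 / 3" if "0 \<le> t" "t \<le> 1" for t
  proof -
    have "2 * t / (1 + 2 * t) \<le> 2 / 3" using that by (simp add: field_simps)
    then show "0 \<le> ?f t" "?f t \<le> 2 / 3"
      using section_map_bounds(1,2)[of \<alpha> t] assms le1 that by auto
  qed
  \<comment> \<open>At 1/8 the upper bound \<open>2 * t / (1 + 2 * t)\<close> is 1/5, so the image
    stays within the range up to 1/4 where \<open>?g\<close> also lies above the identity.\<close>
  have "?f (1 / 8) \<le> 1 / 4" "1 / 8 \<le> ?f (1 / 8)"
    using section_map_bounds(2,3)[of \<alpha> "1 / 8"] assms le1 by auto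
  then have lo: "1 / 8 \<le> ?g (?f (1 / 8))"
    using section_map_bounds(3)[of a "?f (1 / 8)"] assms le1 by auto
  have "2 * ?f 1 / (1 + 2 * ?f 1) \<le> 1" using f[of 1] by (simp add: field_simps)
  moreover have "?g (?f 1) \<le> 2 * ?f 1 / (1 + 2 * ?f 1)"
    using section_map_bounds(2)[of a "?f 1"] assms le1 f[of 1] by auto
  ultimately have hi: "?g (?f 1) \<le> 1"
    by (rule order_trans[rotated])
  have cf: "continuous_on {1 / 8..1} ?f"
    unfolding section_map_def by (intro continuous_intros) auto
  have cg: "continuous_on {0..1} ?g"
    unfolding section_map_def by (intro continuous_intros) auto
  have "?f t \<in> {0..1}" if "t \<in> {1 / 8..1}" for t
    using f[of t] that by auto
  then have "continuous_on {1 / 8..1} (\<lambda>t. ?g (?f t) - t)"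
    by (intro continuous_on_diff continuous_on_compose2[OF cg cf] continuous_on_id image_subsetI)
  then obtain y where y: "1 / 8 \<le> y" "y \<le> 1" "?g (?f y) = y"
    using IVT2'[of "\<lambda>t. ?g (?f t) - t" 1 0 "1 / 8"] lo hi by auto
  define x where "x = ?f y"
  define z where "z = 1 - x - y"
  have x: "0 \<le> x" "x \<le> 2 / 3" using f[of y] y by (auto simp: x_def)
  have ex: "x = \<alpha> * y\<^sup>2 + 2 * y * z"
    using section_map_eq[of y \<alpha>] y by (simp add: x_def z_def)
  have ey: "y = a * x\<^sup>2 + 2 * x * z"
    using section_map_eq[of x a] x y by (simp add: x_def z_def algebra_simps)
  \<comment> \<open>The intermediate value argument does not control the sign of \<open>z\<close>. A
    negative \<open>z\<close> would give \<open>x \<le> y \<le> 2 / 3 * x\<close>, contradicting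
    \<open>y > 0\<close>.\<close>
  have z: "0 \<le> z"
  proof (rule ccontr)
    assume "\<not> 0 \<le> z"
    then have neg: "2 * y * z \<le> 0" "2 * x * z \<le> 0"
      using x y by (auto simp: mult_nonneg_nonpos)
    have sq: "\<alpha> * y\<^sup>2 \<le> y\<^sup>2" "y\<^sup>2 \<le> y" "a * x\<^sup>2 \<le> x\<^sup>2" "x\<^sup>2 \<le> 2 / 3 * x"
      using mult_right_mono[OF x(2) x(1)] x(1) y assms le1
      by (simp_all add: mult_left_le_one_le power2_eq_square)
    have "x \<le> y" "y \<le> 2 / 3 * x" using ex ey neg sq by linarith+
    then show False using x y by linarith
  qed
  \<comment> \<open>The three right-hand sides sum to the square of the coordinate sum, so the third
    equation follows from the first two.\<close>
  have "b * x\<^sup>2 + \<beta> * y\<^sup>2 + z\<^sup>2 + 2 * x * y + (x + y) = (x + y + z)\<^sup>2"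
    using ex ey sums by algebra
  then have ez: "b * x\<^sup>2 + \<beta> * y\<^sup>2 + z\<^sup>2 + 2 * x * y = z"
    by (simp add: z_def)
  show thesis
  proof
    show "vector [x, y, z] \<in> simplex2"
      using x y z by (simp add: simplex2_iff z_def)
    show "V_op \<alpha> \<beta> a b 0 0 1 (vector [x, y, z]) = vector [x, y, z]"
      using ex ey ez by (simp add: V_op_fixed_iff)
    show "(vector [x, y, z] :: real ^ 3) $ 2 > 0" using y by simp
  qed
qed

theorem theorem1:
  fixes \<alpha> \<beta> a b c d e :: real
  assumes "\<alpha> \<ge> 0" "\<beta> \<ge> 0" "a \<ge> 0" "b \<ge> 0" "c \<ge> 0" "d \<ge> 0" "e \<ge> 0"
    and "a + b = 1" "\<alpha> + \<beta> = 1" "c + d + e = 1"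
  shows "(e \<noteq> 1 \<longrightarrow> (\<exists>!x. x \<in> simplex2 \<and> V_op \<alpha> \<beta> a b c d e x = x)) \<and>
         (e = 1 \<longrightarrow> card {x \<in> simplex2. V_op \<alpha> \<beta> a b c d e x = x} = 2 \<and>
                    vector [0, 0, 1] \<in> {x \<in> simplex2. V_op \<alpha> \<beta> a b c d e x = x})"
proof -
  let ?V = "V_op \<alpha> \<beta> a b c d e" and ?v = "vector [0, 0, 1] :: real ^ 3"
  have half: "x $ 3 \<le> 1 / 2" if "x \<in> simplex2" "?V x = x" "x \<noteq> ?v" for x
    by (rule V_op_fixed_coord3_le_half[OF _ _ _ that]) (use assms in auto)
  have uniq: "x = y"
    if "x \<in> simplex2" "?V x = x" "x \<noteq> ?v" "y \<in> simplex2" "?V y = y" "y \<noteq> ?v" for x y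
    using V_op_fixed_unique_half[OF assms] half that by blast
  show ?thesis
  proof (intro conjI impI)
    assume "e \<noteq> 1"
    \<comment> \<open>The third coordinate of \<open>?V ?v\<close> is \<open>e\<close>; with the
      vertex excluded, \<open>uniq\<close> covers every fixed point.\<close>
    then have ne: "?V ?v \<noteq> ?v" by (simp add: V_op_fixed_iff)
    obtain x where "x \<in> simplex2" "?V x = x"
      using brouwer[OF compact_simplex2 convex_simplex2 _ continuous_on_V_op]
        V_op_maps_simplex2[OF assms] vertex3_in_simplex2 by blast
    then show "\<exists>!x. x \<in> simplex2 \<and> ?V x = x"
      using uniq ne by metis
  next
    assume e: "e = 1"
    then have cd: "c = 0" "d = 0" using assms by auto
    have v: "?V ?v = ?v" by (simp add: V_op_fixed_iff e cd)
    then show "?v \<in> {x \<in> simplex2. ?V x = x}"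
      using vertex3_in_simplex2 by simp
    obtain w where w: "w \<in> simplex2" "?V w = w" "w $ 2 > 0"
      using V_op_fixed_nontrivial[of \<alpha> \<beta> a b] assms e cd by metis
    then have "w \<noteq> ?v" by auto
    then have "{x \<in> simplex2. ?V x = x} = {?v, w}"
      using uniq w v vertex3_in_simplex2 by auto
    then show "card {x \<in> simplex2. ?V x = x} = 2"
      using \<open>w \<noteq> ?v\<close> by simp
  qed
qed

end
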